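(* Let $1\le k<n$ and let $(V,\mathcal{H})$ be a $k$-hypergraph with $n=|V|$ vertices. If there are $E_1,E_2\in\mathcal{H}$ and $F_1,F_2\in\overline{\mathcal{H}}$ with $E_1\cap E_2=F_1\cap F_2$ and $E_1\cup E_2=F_1\cup F_2$, then $(V,\mathcal{H})$ is equatable and, moreover, there is a nonzero labeling $y:\binom{V}{k}\to\{0,1\}$ with at most $4$ nonzero values such that for every $v\in V$, $\sum\{y(E):v\in E\in\mathcal{H}\}=\sum\{y(F):v\in F\in\overline{\mathcal{H}}\}$. In particular, if $(V,\mathcal{H})$ is exchangeable then it is equatable.
   Context: A $k$-hypergraph is a pair $(V,\mathcal{H})$ with $V$ a finite set and $\mathcal{H}\subseteq\binom{V}{k}$ a set of $k$-element subsets of $V$ (the edges). Its complement is $\overline{\mathcal{H}}:=\binom{V}{k}\setminus\mathcal{H}$. Equatable: there is a labeling $y:\binom{V}{k}\to\mathbb{R}_{\ge 0}$, not identically zero, such that for every $v\in V$, $\sum\{y(E):v\in E\in\mathcal{H}\}=\sum\{y(F):v\in F\in\overline{\mathcal{H}}\}$. Exchangeable: there are $E_1,E_2\in\mathcal{H}$, $v_1\in E_1\setminus E_2$ and $v_2\in E_2\setminus E_1$ such that $(E_1\setminus\{v_1\})\cup\{v_2\}\in\overline{\mathcal{H}}$ and $(E_2\setminus\{v_2\})\cup\{v_1\}\in\overline{\mathcal{H}}$. *)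

theory Defs
  imports Complex_Main "HOL-Library.Ramsey" "HOL-Library.FuncSet"
begin

definition k_hypergraph :: "nat \<Rightarrow> 'a set \<Rightarrow> 'a set set \<Rightarrow> bool" where
  "k_hypergraph k V H \<longleftrightarrow> finite V \<and> H \<subseteq> nsets V k"

definition compl_edges :: "nat \<Rightarrow> 'a set \<Rightarrow> 'a set set \<Rightarrow> 'a set set" where
  "compl_edges k V H = nsets V k - H"

text \<open>A labeling is a function on \<open>nsets V k\<close>; it is represented by a total function on
  \<open>'a set\<close> of which only the values on \<open>nsets V k\<close> are ever inspected.\<close>

definition nonzero_labeling :: "nat \<Rightarrow> 'a set \<Rightarrow> ('a set \<Rightarrow> real) \<Rightarrow> bool" where
  "nonzero_labeling k V y \<longleftrightarrow> (\<exists>E \<in> nsets V k. y E \<noteq> 0)"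

definition balanced_labeling ::
    "nat \<Rightarrow> 'a set \<Rightarrow> 'a set set \<Rightarrow> ('a set \<Rightarrow> real) \<Rightarrow> bool" where
  "balanced_labeling k V H y \<longleftrightarrow>
     (\<forall>v \<in> V. (\<Sum>E | E \<in> H \<and> v \<in> E. y E) = (\<Sum>F | F \<in> compl_edges k V H \<and> v \<in> F. y F))"

definition equatable :: "nat \<Rightarrow> 'a set \<Rightarrow> 'a set set \<Rightarrow> bool" where
  "equatable k V H \<longleftrightarrow>
     (\<exists>y :: 'a set \<Rightarrow> real. y \<in> nsets V k \<rightarrow> {0..} \<and> nonzero_labeling k V y
        \<and> balanced_labeling k V H y)"

definition exchangeable :: "nat \<Rightarrow> 'a set \<Rightarrow> 'a set set \<Rightarrow> bool" where
  "exchangeable k V H \<longleftrightarrow>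
     (\<exists>E1 \<in> H. \<exists>E2 \<in> H. \<exists>v1 \<in> E1 - E2. \<exists>v2 \<in> E2 - E1.
        (E1 - {v1}) \<union> {v2} \<in> compl_edges k V H \<and> (E2 - {v2}) \<union> {v1} \<in> compl_edges k V H)"

end

theory Submission
  imports Defs "HOL-Library.Indicator_Function"
begin

text \<open>The labeling is the indicator function of the four sets \<open>E1, E2, F1, F2\<close>. A vertex \<open>v\<close>
  lies in as many of two distinct sets \<open>A, B\<close> as the number of the sets \<open>A \<inter> B\<close> and \<open>A \<union> B\<close>
  that contain it. So the two edges and the two non-edges give the same sum at every vertex, as
  they have the same intersection and the same union
  (\<open>sum_indicator_pair\<close>, \<open>balanced_indicator_of_equal_inter_union\<close>).

  An exchange of \<open>v1\<close> and \<open>v2\<close> between \<open>E1\<close> and \<open>E2\<close> preserves their intersection and union, so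
  exchangeability is a special case.\<close>

text \<open>Writing the degree of \<open>v\<close> in \<open>{A, B}\<close> through \<open>A \<inter> B\<close> and \<open>A \<union> B\<close> makes it depend only on
  what the pair of edges and the pair of non-edges have in common.\<close>

lemma sum_indicator_pair:
  assumes "finite S" and "S \<inter> T = {A, B}" and "A \<noteq> B"
  shows "(\<Sum>E | E \<in> S \<and> v \<in> E. indicator T E :: real)
           = of_bool (v \<in> A \<inter> B) + of_bool (v \<in> A \<union> B)"
proof -
  have "(\<Sum>E | E \<in> S \<and> v \<in> E. indicator T E :: real) = card ({E. E \<in> S \<and> v \<in> E} \<inter> T)"
    using assms(1) by (simp add: indicator_def of_bool_def sum.If_cases Int_def)
  also have "{E. E \<in> S \<and> v \<in> E} \<inter> T = {E \<in> {A, B}. v \<in> E}"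
    using assms(2) by blast
  also have "\<dots> = (if v \<in> A then {A} else {}) \<union> (if v \<in> B then {B} else {})"
    by auto
  also have "real (card \<dots>) = of_bool (v \<in> A \<inter> B) + of_bool (v \<in> A \<union> B)"
    using assms(3) by simp
  finally show ?thesis .
qed

lemma balanced_indicator_of_equal_inter_union:
  assumes "k_hypergraph k V H"
    and "E1 \<in> H" "E2 \<in> H" "F1 \<in> compl_edges k V H" "F2 \<in> compl_edges k V H"
    and "E1 \<inter> E2 = F1 \<inter> F2" "E1 \<union> E2 = F1 \<union> F2"
  shows "balanced_labeling k V H (indicator {E1, E2, F1, F2})"
proof -
  have fin: "finite (nsets V k)" and sub: "H \<subseteq> nsets V k"
    using assms(1) by (auto simp: k_hypergraph_def finite_imp_finite_nsets)
  have finH: "finite H" and finC: "finite (compl_edges k V H)"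
    using fin sub by (auto simp: compl_edges_def intro: finite_subset)
  \<comment> \<open>If one pair were degenerate, its intersection would be its union, so all four sets would
    coincide, but an edge is not a non-edge.\<close>
  have "A = B \<longleftrightarrow> A \<inter> B = A \<union> B" for A B :: "'a set"
    by blast
  then have "E1 = E2 \<longleftrightarrow> F1 = F2"
    using assms(6,7) by metis
  then have "E1 \<noteq> E2" and "F1 \<noteq> F2"
    using assms(2,4,6) by (auto simp: compl_edges_def)
  moreover have "H \<inter> {E1, E2, F1, F2} = {E1, E2}"
    and "compl_edges k V H \<inter> {E1, E2, F1, F2} = {F1, F2}"
    using assms(2-5) by (auto simp: compl_edges_def)
  ultimately show ?thesis
    using assms(6,7) finH finC
    by (simp add: balanced_labeling_def sum_indicator_pair del: Int_iff Un_iff)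
qed

lemma zero_one_labeling_of_equal_inter_union:
  assumes "k_hypergraph k V H"
    and "E1 \<in> H" "E2 \<in> H" "F1 \<in> compl_edges k V H" "F2 \<in> compl_edges k V H"
    and "E1 \<inter> E2 = F1 \<inter> F2" "E1 \<union> E2 = F1 \<union> F2"
  shows "\<exists>y :: 'a set \<Rightarrow> real. y \<in> nsets V k \<rightarrow> {0, 1} \<and> nonzero_labeling k V y
           \<and> card {E \<in> nsets V k. y E \<noteq> 0} \<le> 4 \<and> balanced_labeling k V H y"
proof (intro exI conjI)
  let ?T = "{E1, E2, F1, F2}"
  let ?y = "indicator ?T :: 'a set \<Rightarrow> real"
  show "?y \<in> nsets V k \<rightarrow> {0, 1}"
    by (auto simp: indicator_def)
  have "E1 \<in> nsets V k"
    using assms(1,2) by (auto simp: k_hypergraph_def)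
  then show "nonzero_labeling k V ?y"
    unfolding nonzero_labeling_def by (intro bexI[of _ E1]) simp_all
  have "card {E \<in> nsets V k. ?y E \<noteq> 0} \<le> card ?T"
    by (rule card_mono) (auto simp: indicator_def split: if_splits)
  also have "\<dots> \<le> 4"
    using card_length[of "[E1, E2, F1, F2]"] by simp
  finally show "card {E \<in> nsets V k. ?y E \<noteq> 0} \<le> 4" .
  show "balanced_labeling k V H ?y"
    using assms by (rule balanced_indicator_of_equal_inter_union)
qed

lemma equatable_of_equal_inter_union:
  assumes "k_hypergraph k V H"
    and "E1 \<in> H" "E2 \<in> H" "F1 \<in> compl_edges k V H" "F2 \<in> compl_edges k V H"
    and "E1 \<inter> E2 = F1 \<inter> F2" "E1 \<union> E2 = F1 \<union> F2"
  shows "equatable k V H"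
proof -
  obtain y :: "'a set \<Rightarrow> real" where "y \<in> nsets V k \<rightarrow> {0, 1}"
    and "nonzero_labeling k V y" "balanced_labeling k V H y"
    using zero_one_labeling_of_equal_inter_union[OF assms] by blast
  moreover from this(1) have "y \<in> nsets V k \<rightarrow> {0..}"
    by (force simp: Pi_iff)
  ultimately show ?thesis
    by (auto simp: equatable_def)
qed

lemma equatable_of_exchangeable:
  assumes "k_hypergraph k V H" and "exchangeable k V H"
  shows "equatable k V H"
proof -
  obtain E1 E2 v1 v2 where "E1 \<in> H" "E2 \<in> H"
    and v: "v1 \<in> E1 - E2" "v2 \<in> E2 - E1"
    and "(E1 - {v1}) \<union> {v2} \<in> compl_edges k V H" "(E2 - {v2}) \<union> {v1} \<in> compl_edges k V H"
    using assms(2) unfolding exchangeable_def by blast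
  moreover have "E1 \<inter> E2 = ((E1 - {v1}) \<union> {v2}) \<inter> ((E2 - {v2}) \<union> {v1})"
    and "E1 \<union> E2 = ((E1 - {v1}) \<union> {v2}) \<union> ((E2 - {v2}) \<union> {v1})"
    using v by auto
  ultimately show ?thesis
    using equatable_of_equal_inter_union[OF assms(1)] by metis
qed

theorem lemma2p2:
  fixes V :: "'a set" and H :: "'a set set" and k n :: nat
  assumes "1 \<le> k" and "k < n" and "k_hypergraph k V H" and "card V = n"
  shows "((\<exists>E1 \<in> H. \<exists>E2 \<in> H. \<exists>F1 \<in> compl_edges k V H. \<exists>F2 \<in> compl_edges k V H.
             E1 \<inter> E2 = F1 \<inter> F2 \<and> E1 \<union> E2 = F1 \<union> F2)
          \<longrightarrow> equatable k V H
              \<and> (\<exists>y :: 'a set \<Rightarrow> real. y \<in> nsets V k \<rightarrow> {0, 1} \<and> nonzero_labeling k V y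
                    \<and> card {E \<in> nsets V k. y E \<noteq> 0} \<le> 4
                    \<and> balanced_labeling k V H y))
         \<and> (exchangeable k V H \<longrightarrow> equatable k V H)"
proof (intro conjI impI; (elim bexE conjE)?)
  fix E1 E2 F1 F2
  assume quad: "E1 \<in> H" "E2 \<in> H" "F1 \<in> compl_edges k V H" "F2 \<in> compl_edges k V H"
    "E1 \<inter> E2 = F1 \<inter> F2" "E1 \<union> E2 = F1 \<union> F2"
  show "equatable k V H"
    by (rule equatable_of_equal_inter_union[OF assms(3) quad])
  show "\<exists>y :: 'a set \<Rightarrow> real. y \<in> nsets V k \<rightarrow> {0, 1} \<and> nonzero_labeling k V y
          \<and> card {E \<in> nsets V k. y E \<noteq> 0} \<le> 4 \<and> balanced_labeling k V H y"
    by (rule zero_one_labeling_of_equal_inter_union[OF assms(3) quad])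
next
  assume "exchangeable k V H"
  then show "equatable k V H"
    by (rule equatable_of_exchangeable[OF assms(3)])
qed

end
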